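(* Let $X=\{X(t), t\in\mathbb{Z}\}$ be a (strictly) stationary real-valued max-infinitely divisible process, let $l=\operatorname{essinf} X(0)\in[-\infty,\infty)$, and for $a>l$ (with $a\in\mathbb{R}$) and $t\in\mathbb{Z}$ let $$\tau_a(t)=\log \mathbb{P}[X(0)\le a, X(t)\le a]-\log\mathbb{P}[X(0)\le a]-\log\mathbb{P}[X(t)\le a].$$ Then the following conditions are equivalent: 1. $X$ is ergodic. 2. $X$ is weakly mixing. 3. For every $a>l$, $\lim_{n\to\infty}\frac1n\sum_{t=1}^n\tau_a(t)=0$.
   Context: A stochastic process $X=\{X(t),t\in\mathbb{Z}\}$ is called max-infinitely divisible (max-i.d.) if for every $n\in\mathbb{N}$ it can be represented (in law) as the maximum, taken componentwise (pointwise in $t$), of $n$ independent identically distributed stochastic processes; equivalently, for every finite-dimensional distribution function $F$ of $X$ and every $n\in\mathbb N$, $F^{1/n}$ is again a distribution function. Ergodic-theoretic notions refer to the shift acting on the law of $X$ on $\mathbb{R}^{\mathbb{Z}}$ with the product $\sigma$-algebra. For a measurable set $C\subset\mathbb{R}^{\mathbb{Z}}$, the event $A=\{X\in C\}$ and $t\in\mathbb{Z}$, write $A_t=\{(X(s+t))_{s\in\mathbb{Z}}\in C\}$. The process $X$ is ergodic if $\lim_{n\to\infty}\frac1n\sum_{t=1}^n\mathbb{P}[A\cap B_t]=\mathbb{P}[A]\mathbb{P}[B]$ for all such events $A,B$ (equivalently, every shift-invariant event has probability $0$ or $1$), and weakly mixing if $\lim_{n\to\infty}\frac1n\sum_{t=1}^n|\mathbb{P}[A\cap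 B_t]-\mathbb{P}[A]\mathbb{P}[B]|=0$ for all such events $A,B$. *)

theory Defs
  imports "HOL-Probability.Probability"
begin

text \<open>A real-valued process indexed by \<open>\<int>\<close> on a probability space \<open>M\<close> is a family
  \<open>X :: int \<Rightarrow> 'a \<Rightarrow> real\<close> of random variables; its paths live in \<open>\<real>\<^sup>\<int>\<close>
  with the product \<open>\<sigma>\<close>-algebra.\<close>

definition path_space :: "(int \<Rightarrow> real) measure" where
  "path_space = PiM UNIV (\<lambda>_. borel)"

definition process_law :: "'a measure \<Rightarrow> (int \<Rightarrow> 'a \<Rightarrow> real) \<Rightarrow> (int \<Rightarrow> real) measure" where
  "process_law M X = distr M path_space (\<lambda>\<omega> t. X t \<omega>)"

definition stationary :: "'a measure \<Rightarrow> (int \<Rightarrow> 'a \<Rightarrow> real) \<Rightarrow> bool" where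
  "stationary M X \<longleftrightarrow> (\<forall>h. process_law M (\<lambda>t. X (t + h)) = process_law M X)"

text \<open>The \<open>n\<close> i.i.d. processes may live on a probability space of their own, since the
  representation is only in law. Fixing \<open>nat \<Rightarrow> int \<Rightarrow> real\<close> as the type of its
  points is no restriction: any \<open>n\<close> processes have a version with the same joint law on
  \<open>(\<real>\<^sup>\<int>)\<^sup>\<nat>\<close>. Measurability of the \<open>Y i\<close> is part of \<open>indep_vars\<close>.\<close>

definition max_infinitely_divisible :: "'a measure \<Rightarrow> (int \<Rightarrow> 'a \<Rightarrow> real) \<Rightarrow> bool" where
  "max_infinitely_divisible M X \<longleftrightarrow>
    (\<forall>n\<ge>1::nat. \<exists>(N :: (nat \<Rightarrow> int \<Rightarrow> real) measure) (Y :: nat \<Rightarrow> int \<Rightarrow> _ \<Rightarrow> real).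
       prob_space N \<and>
       prob_space.indep_vars N (\<lambda>_. path_space) (\<lambda>i \<omega> t. Y i t \<omega>) {..<n} \<and>
       (\<forall>i<n. process_law N (Y i) = process_law N (Y 0)) \<and>
       process_law M X = process_law N (\<lambda>t \<omega>. Max ((\<lambda>i. Y i t \<omega>) ` {..<n})))"

text \<open>For \<open>A = {X \<in> C}\<close> this is the shifted event \<open>A\<^sub>t\<close>; in particular
  \<open>A = shifted_event M X C 0\<close>.\<close>

definition shifted_event ::
  "'a measure \<Rightarrow> (int \<Rightarrow> 'a \<Rightarrow> real) \<Rightarrow> (int \<Rightarrow> real) set \<Rightarrow> int \<Rightarrow> 'a set" where
  "shifted_event M X C t = {\<omega> \<in> space M. (\<lambda>s. X (s + t) \<omega>) \<in> C}"

definition ergodic_process :: "'a measure \<Rightarrow> (int \<Rightarrow> 'a \<Rightarrow> real) \<Rightarrow> bool" where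
  "ergodic_process M X \<longleftrightarrow>
    (\<forall>C\<in>sets path_space. \<forall>D\<in>sets path_space.
       (\<lambda>n. (1 / real n) *
          (\<Sum>t=1..n. measure M (shifted_event M X C 0 \<inter> shifted_event M X D (int t))))
       \<longlonglongrightarrow> measure M (shifted_event M X C 0) * measure M (shifted_event M X D 0))"

definition weakly_mixing_process :: "'a measure \<Rightarrow> (int \<Rightarrow> 'a \<Rightarrow> real) \<Rightarrow> bool" where
  "weakly_mixing_process M X \<longleftrightarrow>
    (\<forall>C\<in>sets path_space. \<forall>D\<in>sets path_space.
       (\<lambda>n. (1 / real n) *
          (\<Sum>t=1..n. \<bar>measure M (shifted_event M X C 0 \<inter> shifted_event M X D (int t))
             - measure M (shifted_event M X C 0) * measure M (shifted_event M X D 0)\<bar>))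
       \<longlonglongrightarrow> 0)"

definition essinf :: "'a measure \<Rightarrow> ('a \<Rightarrow> real) \<Rightarrow> ereal" where
  "essinf M f = Sup {z. AE \<omega> in M. z \<le> ereal (f \<omega>)}"

text \<open>The arguments of the logarithms are positive for \<open>a > essinf M (X 0)\<close> when \<open>X\<close>
  is stationary and max-infinitely divisible (the latter makes the joint probability at least
  the product of the marginal ones), so the convention for \<open>ln 0\<close> plays no role.\<close>

definition tau :: "'a measure \<Rightarrow> (int \<Rightarrow> 'a \<Rightarrow> real) \<Rightarrow> real \<Rightarrow> int \<Rightarrow> real" where
  "tau M X a t =
     ln (measure M {\<omega> \<in> space M. X 0 \<omega> \<le> a \<and> X t \<omega> \<le> a})
     - ln (measure M {\<omega> \<in> space M. X 0 \<omega> \<le> a})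
     - ln (measure M {\<omega> \<in> space M. X t \<omega> \<le> a})"

end

theory Submission
  imports Defs "HOL-Real_Asymp.Real_Asymp"
begin

text \<open>
  Weak mixing implies ergodicity for every process, by the triangle inequality. What is special to
  a max-infinitely divisible \<open>X\<close> is that its dependence has a sign and is controlled by pairs of
  coordinates, so that no cancellation can hide in the Cesaro averages.

  An orthant is an event \<open>{x. \<forall>(t, a)\<in>S. x t \<le> a}\<close> with \<open>S\<close> finite. If the law \<open>L\<close> of \<open>X\<close> is
  that of the maximum of \<open>n\<close> independent processes with law \<open>K\<^sub>n\<close>, then
  \<open>L A = (K\<^sub>n A) ^ n\<close> for every orthant \<open>A\<close>, hence \<open>n (1 - K\<^sub>n A) \<longrightarrow> - ln (L A)\<close>. Inclusion and
  exclusion turns this into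
  \<open>ln (L (A \<inter> B)) - ln (L A) - ln (L B) = lim n (K\<^sub>n (- A \<inter> - B))\<close>.
  This quantity, called the redundancy of \<open>A\<close> and \<open>B\<close>, is the mass that the exponent measure of \<open>X\<close>
  gives to \<open>- A \<inter> - B\<close>, but the proof works with the limit alone. Being a limit of masses of
  \<open>- A \<inter> - B\<close>, it is nonnegative, it decreases when \<open>A\<close> or \<open>B\<close> grows, and, as \<open>- A\<close> and \<open>- B\<close> are
  finite unions of sets \<open>{x. x t > b}\<close>, it is at most a finite sum of terms \<open>tau a k\<close>, where \<open>a\<close> is a lower bound of all levels that occur
  (\<open>redundancy_le_sum\<close>). As also \<open>0 \<le> L (A \<inter> B) - L A * L B \<le>\<close> redundancy, Cesaro convergence of
  \<open>tau\<close> to \<open>0\<close> gives weak mixing for orthants with levels above the essential infimum. An orthant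
  of positive probability has all its levels at least equal to the essential infimum, and is the
  limit of orthants with slightly raised levels. A Dynkin class argument, once in each of the two
  events, extends weak mixing to the product \<open>\<sigma>\<close>-algebra
  (\<open>cesaro_null_decorrelation_generator\<close>).

  Conversely, let \<open>X\<close> be ergodic, \<open>a\<close> above the essential infimum, \<open>p = \<P>(X 0 \<le> a) > 0\<close> and
  \<open>q t = \<P>(X 0 \<le> a, X t \<le> a)\<close>. By nonnegativity,
  \<open>0 \<le> tau a t = ln (q t / p\<^sup>2) \<le> q t / p\<^sup>2 - 1\<close>, and the right-hand side has Cesaro limit \<open>0\<close> by
  ergodicity.
\<close>

section \<open>Cesaro-null sequences\<close>

definition cesaro_null :: "(nat \<Rightarrow> real) \<Rightarrow> bool" where
  "cesaro_null f \<longleftrightarrow> (\<lambda>n. (1 / real n) * (\<Sum>t=1..n. f t)) \<longlonglongrightarrow> 0"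

lemma cesaro_null_zero [simp]: "cesaro_null (\<lambda>_. 0)"
  by (simp add: cesaro_null_def)

lemma cesaro_null_add:
  assumes "cesaro_null f" "cesaro_null g"
  shows "cesaro_null (\<lambda>t. f t + g t)"
  using tendsto_add[OF assms[unfolded cesaro_null_def]]
  by (simp add: cesaro_null_def sum.distrib add_divide_distrib)

lemma cesaro_null_sum:
  assumes "\<And>i. i \<in> I \<Longrightarrow> cesaro_null (f i)"
  shows "cesaro_null (\<lambda>t. \<Sum>i\<in>I. f i t)"
  using assms
  by (induction I rule: infinite_finite_induct) (simp_all add: cesaro_null_add)

lemma cesaro_null_approx:
  assumes "\<And>t. 0 \<le> f t"
    and "\<And>e. 0 < e \<Longrightarrow> \<exists>g. cesaro_null g \<and> (\<forall>t. f t \<le> g t + e)"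
  shows "cesaro_null f"
  unfolding cesaro_null_def LIMSEQ_iff
proof (intro allI impI)
  fix e :: real assume "0 < e"
  then obtain g where g: "cesaro_null g" "\<And>t. f t \<le> g t + e / 2"
    using assms(2)[of "e / 2"] by auto
  from g(1) \<open>0 < e\<close> obtain N where
    N: "\<And>n. n \<ge> N \<Longrightarrow> \<bar>(1 / real n) * (\<Sum>t=1..n. g t)\<bar> < e / 2"
    unfolding cesaro_null_def LIMSEQ_iff by (metis half_gt_zero real_norm_def diff_zero)
  have "\<bar>(1 / real n) * (\<Sum>t=1..n. f t)\<bar> < e" if n: "n \<ge> max N 1" for n
  proof -
    have "(\<Sum>t=1..n. f t) \<le> (\<Sum>t=1..n. g t + e / 2)"
      by (intro sum_mono g)
    also have "\<dots> = (\<Sum>t=1..n. g t) + real n * (e / 2)"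
      by (simp add: sum.distrib)
    finally have "(1 / real n) * (\<Sum>t=1..n. f t) \<le> (1 / real n) * (\<Sum>t=1..n. g t) + e / 2"
      using n by (simp add: field_simps)
    moreover have "0 \<le> (1 / real n) * (\<Sum>t=1..n. f t)"
      by (simp add: assms(1) sum_nonneg)
    moreover have "(1 / real n) * (\<Sum>t=1..n. g t) < e / 2"
      using N[of n] n by linarith
    ultimately show ?thesis by linarith
  qed
  then show "\<exists>N. \<forall>n\<ge>N. norm ((1 / real n) * (\<Sum>t=1..n. f t) - 0) < e"
    by (intro exI[of _ "max N 1"]) simp
qed

lemma cesaro_null_mono:
  assumes "cesaro_null g" "\<And>t. 0 \<le> f t" "\<And>t. f t \<le> g t"
  shows "cesaro_null f"
proof (rule cesaro_null_approx)
  fix e :: real assume "0 < e"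
  then show "\<exists>g. cesaro_null g \<and> (\<forall>t. f t \<le> g t + e)"
    using assms(1,3) by (metis add.commute add_increasing less_imp_le)
qed (rule assms(2))

text \<open>A unit shift of the argument changes the sum over \<open>{1..n}\<close> by only two boundary terms. They
  may sit at negative times, which is why \<open>f\<close> is defined on the integers and bounded there.\<close>

lemma cesaro_null_shift:
  fixes f :: "int \<Rightarrow> real"
  assumes null: "cesaro_null (\<lambda>t. f (int t))" and bound: "\<And>t. \<bar>f t\<bar> \<le> B"
  shows "cesaro_null (\<lambda>t. f (int t + k))"
proof -
  have step: "cesaro_null (\<lambda>t. f (int t + i + 1)) \<longleftrightarrow> cesaro_null (\<lambda>t. f (int t + i))" for i
  proof -
    have tele: "(\<Sum>t=1..n. f (int t + i + 1) - f (int t + i)) = f (int n + i + 1) - f (i + 1)" for n :: nat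
      by (induction n) (simp_all add: algebra_simps)
    have "\<bar>f (int n + i + 1) - f (i + 1)\<bar> \<le> 2 * B" for n :: nat
      using bound[of "int n + i + 1"] bound[of "i + 1"] by linarith
    then have "(\<lambda>n. (1 / real n) * (f (int n + i + 1) - f (i + 1))) \<longlonglongrightarrow> 0"
      by (intro lim_null_mult_right_bounded[where B = "2 * B"] lim_1_over_n) simp
    then have diff: "(\<lambda>n. (1 / real n) * (\<Sum>t=1..n. f (int t + i + 1))
          - (1 / real n) * (\<Sum>t=1..n. f (int t + i))) \<longlonglongrightarrow> 0"
      unfolding tele[symmetric] sum_subtractf right_diff_distrib .
    show ?thesis
      unfolding cesaro_null_def
      using Lim_transform[OF _ diff] Lim_transform2[OF _ diff] by blast
  qed
  show ?thesis
  proof (induction k rule: int_induct[where k = 0])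
    case base then show ?case using null by simp
  next
    case (step1 i) then show ?case using step[of i] by (simp add: add.assoc)
  next
    case (step2 i) then show ?case using step[of "i - 1"] by (simp add: add.assoc)
  qed
qed

section \<open>Asymptotic independence is a Dynkin property\<close>

definition measure_preserving_maps :: "'a measure \<Rightarrow> ('i \<Rightarrow> 'a \<Rightarrow> 'a) \<Rightarrow> bool" where
  "measure_preserving_maps P T \<longleftrightarrow> (\<forall>t. T t \<in> measurable P P \<and> distr P P (T t) = P)"

context prob_space
begin

definition decorrelation :: "'a set \<Rightarrow> 'a set \<Rightarrow> real" where
  "decorrelation U V = \<bar>prob (U \<inter> V) - prob U * prob V\<bar>"

lemma decorrelation_nonneg [simp]: "0 \<le> decorrelation U V"
  by (simp add: decorrelation_def)

lemma decorrelation_commute: "decorrelation U V = decorrelation V U"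
  by (simp add: decorrelation_def Int_commute mult.commute)

lemma decorrelation_null_set:
  assumes "U \<in> events" "V \<in> events" "prob U = 0"
  shows "decorrelation U V = 0"
proof -
  have "prob (U \<inter> V) \<le> prob U" using assms by (intro finite_measure_mono) auto
  with assms show ?thesis by (simp add: decorrelation_def measure_le_0_iff)
qed

lemma decorrelation_compl:
  assumes "U \<in> events" "V \<in> events"
  shows "decorrelation (space M - U) V = decorrelation U V"
proof -
  have "(space M - U) \<inter> V = V - U \<inter> V" using sets.sets_into_space[OF assms(2)] by auto
  then have "prob ((space M - U) \<inter> V) = prob V - prob (U \<inter> V)"
    using assms by (simp add: finite_measure_Diff)
  then show ?thesis
    using assms by (simp add: decorrelation_def prob_compl algebra_simps)
qed

lemma decorrelation_Un_disjoint:
  assumes "U \<in> events" "W \<in> events" "V \<in> events" "U \<inter> W = {}"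
  shows "decorrelation (U \<union> W) V \<le> decorrelation U V + decorrelation W V"
proof -
  have "prob ((U \<union> W) \<inter> V) = prob (U \<inter> V) + prob (W \<inter> V)"
    using assms by (subst finite_measure_Union[symmetric]) (auto simp: Int_Un_distrib2)
  moreover have "prob (U \<union> W) = prob U + prob W"
    using assms by (simp add: finite_measure_Union)
  ultimately show ?thesis
    by (simp add: decorrelation_def algebra_simps)
qed

lemma decorrelation_diff_le:
  assumes "U \<in> events" "W \<in> events" "V \<in> events" "U \<subseteq> W"
  shows "\<bar>decorrelation W V - decorrelation U V\<bar> \<le> prob (W - U)"
proof -
  have 1: "prob (W \<inter> V) = prob (U \<inter> V) + prob ((W - U) \<inter> V)"
    using assms by (subst finite_measure_Union[symmetric]) (auto intro!: arg_cong[where f = prob])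
  have 2: "prob W = prob U + prob (W - U)"
    using assms by (simp add: finite_measure_Diff)
  have 3: "prob ((W - U) \<inter> V) \<le> prob (W - U)"
    using assms by (intro finite_measure_mono) auto
  have 4: "prob (W - U) * prob V \<le> prob (W - U)"
    by (simp add: mult_left_le)
  have 5: "0 \<le> prob (W - U) * prob V" by simp
  have "\<bar>(prob (W \<inter> V) - prob W * prob V) - (prob (U \<inter> V) - prob U * prob V)\<bar> \<le> prob (W - U)"
    using 3 4 5 measure_nonneg[of M "(W - U) \<inter> V"] unfolding 1 2 distrib_right by linarith
  then show ?thesis unfolding decorrelation_def by linarith
qed

lemma
  assumes "measure_preserving_maps M T" "C \<in> events"
  shows preimage_event: "T t -` C \<inter> space M \<in> events"
    and prob_preimage: "prob (T t -` C \<inter> space M) = prob C"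
proof -
  have T: "T t \<in> measurable M M" "distr M M (T t) = M"
    using assms by (auto simp: measure_preserving_maps_def)
  show "T t -` C \<inter> space M \<in> events" using T assms by simp
  show "prob (T t -` C \<inter> space M) = prob C"
    using measure_distr[OF T(1) assms(2)] T(2) by simp
qed

text \<open>As the maps preserve the measure, replacing \<open>C\<close> by a nested \<open>D\<close> changes the decorrelation by
  at most the difference of the probabilities, uniformly in \<open>t\<close>, and Cesaro averages keep such
  uniform errors small. Both directions of nesting occur: inner approximations for countable
  unions, outer ones for orthants whose levels touch the essential infimum.\<close>

lemma cesaro_null_decorrelation_approx:
  assumes T: "measure_preserving_maps M T" and V: "\<And>t. V t \<in> events" and C: "C \<in> events"
    and approx: "\<And>e. 0 < e \<Longrightarrow> \<exists>D\<in>events. (D \<subseteq> C \<or> C \<subseteq> D) \<and> \<bar>prob C - prob D\<bar> < e \<and>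
      cesaro_null (\<lambda>t. decorrelation (T t -` D \<inter> space M) (V t))"
  shows "cesaro_null (\<lambda>t. decorrelation (T t -` C \<inter> space M) (V t))"
proof (rule cesaro_null_approx)
  fix e :: real assume "0 < e"
  then obtain D where D: "D \<in> events" "D \<subseteq> C \<or> C \<subseteq> D" "\<bar>prob C - prob D\<bar> < e"
    "cesaro_null (\<lambda>t. decorrelation (T t -` D \<inter> space M) (V t))"
    using approx by blast
  have le: "\<bar>decorrelation (T t -` F \<inter> space M) (V t) - decorrelation (T t -` E \<inter> space M) (V t)\<bar>
      \<le> prob F - prob E" if "E \<subseteq> F" "E \<in> events" "F \<in> events" for E F t
  proof -
    have "\<bar>decorrelation (T t -` F \<inter> space M) (V t) - decorrelation (T t -` E \<inter> space M) (V t)\<bar>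
      \<le> prob (T t -` F \<inter> space M - T t -` E \<inter> space M)"
      by (rule decorrelation_diff_le) (use that T V preimage_event in auto)
    also have "\<dots> = prob F - prob E"
      using that T by (subst finite_measure_Diff) (auto simp: prob_preimage preimage_event)
    finally show ?thesis .
  qed
  have "decorrelation (T t -` C \<inter> space M) (V t) \<le> decorrelation (T t -` D \<inter> space M) (V t) + e" for t
    using D(2) le[OF _ D(1) C, of t] le[OF _ C D(1), of t] D(3) by fastforce
  with D(4) show "\<exists>g. cesaro_null g \<and>
      (\<forall>t. decorrelation (T t -` C \<inter> space M) (V t) \<le> g t + e)" by blast
qed simp

text \<open>Complements leave the decorrelation unchanged, finite disjoint unions at most add it up, and a
  countable union is approximated by finite ones. The second events \<open>V t\<close> are arbitrary, so that
  the lemma serves for either of the two events in weak mixing: with the identity in place of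
  \<open>T\<close> for the first, and with constant \<open>V\<close> for the second.\<close>

lemma cesaro_null_decorrelation_sigma_sets:
  assumes T: "measure_preserving_maps M T" and V: "\<And>t. V t \<in> events"
    and G: "Int_stable G" "G \<subseteq> Pow (space M)" "events = sigma_sets (space M) G"
    and null: "\<And>C. C \<in> G \<Longrightarrow> cesaro_null (\<lambda>t. decorrelation (T t -` C \<inter> space M) (V t))"
    and C: "C \<in> events"
  shows "cesaro_null (\<lambda>t. decorrelation (T t -` C \<inter> space M) (V t))"
proof (rule sigma_sets_induct_disjoint[OF G(1,2) C[unfolded G(3)],
      where P = "\<lambda>C. cesaro_null (\<lambda>t. decorrelation (T t -` C \<inter> space M) (V t))"])
  show "cesaro_null (\<lambda>t. decorrelation (T t -` {} \<inter> space M) (V t))"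
    by (simp add: decorrelation_def)
next
  fix A assume A: "A \<in> sigma_sets (space M) G"
    "cesaro_null (\<lambda>t. decorrelation (T t -` A \<inter> space M) (V t))"
  have "T t -` (space M - A) \<inter> space M = space M - (T t -` A \<inter> space M)" for t
  proof -
    have "T t \<in> measurable M M" using T by (simp add: measure_preserving_maps_def)
    then have "T t x \<in> space M" if "x \<in> space M" for x
      using that by (rule measurable_space)
    then show ?thesis by auto
  qed
  then show "cesaro_null (\<lambda>t. decorrelation (T t -` (space M - A) \<inter> space M) (V t))"
    using A T V by (simp add: decorrelation_compl preimage_event G(3)[symmetric])
next
  fix A :: "nat \<Rightarrow> 'a set"
  assume disj: "disjoint_family A" and A': "range A \<subseteq> sigma_sets (space M) G"
    and nullA: "\<And>i. cesaro_null (\<lambda>t. decorrelation (T t -` A i \<inter> space M) (V t))"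
  have A: "A i \<in> events" for i using A' G(3) by auto
  have fin: "cesaro_null (\<lambda>t. decorrelation (T t -` (\<Union>i<n. A i) \<inter> space M) (V t))" for n
  proof (induction n)
    case 0 show ?case by (simp add: decorrelation_def)
  next
    case (Suc n)
    have "decorrelation (T t -` (\<Union>i<Suc n. A i) \<inter> space M) (V t)
      \<le> decorrelation (T t -` (\<Union>i<n. A i) \<inter> space M) (V t) + decorrelation (T t -` A n \<inter> space M) (V t)"
      for t
    proof -
      let ?U = "T t -` (\<Union>i<n. A i) \<inter> space M" and ?W = "T t -` A n \<inter> space M"
      have "T t -` (\<Union>i<Suc n. A i) \<inter> space M = ?U \<union> ?W"
        by (auto simp: lessThan_Suc)
      moreover have "A i \<inter> A n = {}" if "i < n" for i
        using disjoint_family_onD[OF disj, of i n] that by simp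
      then have "?U \<inter> ?W = {}" by blast
      moreover have "?U \<in> events"
        by (rule preimage_event[OF T]) (use A in auto)
      moreover have "?W \<in> events"
        by (rule preimage_event[OF T A])
      ultimately show ?thesis
        using decorrelation_Un_disjoint[of ?U ?W "V t"] V by simp
    qed
    then show ?case
      by (intro cesaro_null_mono[OF cesaro_null_add[OF Suc nullA[of n]]]) auto
  qed
  have lim: "(\<lambda>n. prob (\<Union>i<n. A i)) \<longlonglongrightarrow> prob (\<Union>n. \<Union>i<n. A i)"
    using A by (intro finite_Lim_measure_incseq) (auto simp: incseq_def intro: less_le_trans)
  have eq: "(\<Union>n. \<Union>i<n. A i) = (\<Union>i. A i)" by auto
  show "cesaro_null (\<lambda>t. decorrelation (T t -` (\<Union>i. A i) \<inter> space M) (V t))"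
  proof (rule cesaro_null_decorrelation_approx[OF T V])
    fix e :: real assume "0 < e"
    with lim obtain n where "\<bar>prob (\<Union>i<n. A i) - prob (\<Union>i. A i)\<bar> < e"
      unfolding eq LIMSEQ_iff by auto
    then show "\<exists>D\<in>events. (D \<subseteq> (\<Union>i. A i) \<or> (\<Union>i. A i) \<subseteq> D) \<and> \<bar>prob (\<Union>i. A i) - prob D\<bar> < e \<and>
        cesaro_null (\<lambda>t. decorrelation (T t -` D \<inter> space M) (V t))"
      using fin[of n] A by (intro bexI[of _ "\<Union>i<n. A i"]) (auto simp: abs_minus_commute)
  qed (use A in auto)
qed (rule null)

lemma cesaro_null_decorrelation_generator:
  assumes T: "measure_preserving_maps M T"
    and G: "Int_stable G" "G \<subseteq> Pow (space M)" "events = sigma_sets (space M) G"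
    and null: "\<And>C D. C \<in> G \<Longrightarrow> D \<in> G \<Longrightarrow> cesaro_null (\<lambda>t. decorrelation C (T t -` D \<inter> space M))"
    and C: "C \<in> events" and D: "D \<in> events"
  shows "cesaro_null (\<lambda>t. decorrelation C (T t -` D \<inter> space M))"
proof -
  have id: "measure_preserving_maps M (\<lambda>t::nat. \<lambda>x. x)"
    by (simp add: measure_preserving_maps_def distr_id2)
  have left: "cesaro_null (\<lambda>t. decorrelation C (T t -` D \<inter> space M))" if D: "D \<in> G" for D
  proof -
    have "cesaro_null (\<lambda>t. decorrelation ((\<lambda>x. x) -` C \<inter> space M) (T t -` D \<inter> space M))"
    proof (rule cesaro_null_decorrelation_sigma_sets[OF id _ G _ C])
      show "T t -` D \<inter> space M \<in> events" for t
        using preimage_event[OF T] D G(3) by auto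
      show "cesaro_null (\<lambda>t. decorrelation ((\<lambda>x. x) -` C \<inter> space M) (T t -` D \<inter> space M))"
        if "C \<in> G" for C
        using null[OF that D] that G(2) by (simp add: Int_absorb2 subset_iff Pow_def)
    qed
    then show ?thesis using sets.sets_into_space[OF C] by (simp add: Int_absorb2)
  qed
  have "cesaro_null (\<lambda>t. decorrelation (T t -` D \<inter> space M) C)"
    by (rule cesaro_null_decorrelation_sigma_sets[OF T _ G _ D])
       (use C left in \<open>simp_all add: decorrelation_commute\<close>)
  then show ?thesis by (simp add: decorrelation_commute)
qed

end

section \<open>Orthants of paths\<close>

text \<open>The constraints form a set of pairs, possibly with several levels for the same time: so an
  intersection of orthants is given by the union of the constraint sets.\<close>

definition orthant :: "(int \<times> real) set \<Rightarrow> (int \<Rightarrow> real) set" where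
  "orthant S = {x. \<forall>(t, a)\<in>S. x t \<le> a}"

definition shift :: "int \<Rightarrow> (int \<Rightarrow> real) \<Rightarrow> (int \<Rightarrow> real)" where
  "shift h x = (\<lambda>s. x (s + h))"

lemma space_path_space [simp]: "space path_space = UNIV"
  by (simp add: path_space_def space_PiM)

lemma coordinate_measurable [measurable]: "(\<lambda>x. x t) \<in> borel_measurable path_space"
  unfolding path_space_def by simp

lemma measurable_path_spaceI:
  assumes "\<And>t. (\<lambda>x. f x t) \<in> borel_measurable M"
  shows "f \<in> measurable M path_space"
  unfolding path_space_def
  using measurable_PiM_single'[of UNIV "\<lambda>t x. f x t" M "\<lambda>_. borel"] assms by simp

lemma shift_measurable [measurable]: "shift h \<in> measurable path_space path_space"
  unfolding shift_def by (intro measurable_path_spaceI) simp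

lemma orthant_Un: "orthant (S \<union> S') = orthant S \<inter> orthant S'"
  by (auto simp: orthant_def)

lemma orthant_single: "orthant {(t, a)} = {x. x t \<le> a}"
  by (auto simp: orthant_def)

lemma orthant_antimono: "S' \<subseteq> S \<Longrightarrow> orthant S \<subseteq> orthant S'"
  by (auto simp: orthant_def)

lemma shift_vimage_orthant:
  "shift h -` orthant S = orthant ((\<lambda>(t, a). (t + h, a)) ` S)"
  by (simp add: orthant_def shift_def case_prod_beta vimage_def)

lemma orthant_in_sets [measurable]:
  assumes "finite S"
  shows "orthant S \<in> sets path_space"
proof -
  have "{x \<in> space path_space. \<forall>p\<in>S. x (fst p) \<le> snd p} \<in> sets path_space"
    using assms by measurable
  then show ?thesis by (simp add: orthant_def case_prod_beta)
qed

lemma Int_stable_orthants: "Int_stable {orthant S | S. finite S}"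
proof (rule Int_stableI)
  fix A B assume "A \<in> {orthant S | S. finite S}" "B \<in> {orthant S | S. finite S}"
  then obtain S S' where "finite (S \<union> S')" "A \<inter> B = orthant (S \<union> S')"
    by (auto simp: orthant_Un)
  then show "A \<inter> B \<in> {orthant S | S. finite S}" by blast
qed

lemma sets_path_space_orthants:
  "sets path_space = sigma_sets UNIV {orthant S | S. finite S}" (is "_ = sigma_sets UNIV ?G")
proof
  have "?G \<subseteq> sets path_space" by auto
  then show "sigma_sets UNIV ?G \<subseteq> sets path_space"
    using sets.sigma_sets_subset[of ?G path_space] by simp
  have *: "(\<lambda>x. x t) \<in> borel_measurable (sigma UNIV ?G)" for t
  proof (rule borel_measurableI_le)
    fix a :: real
    have "orthant {(t, a)} \<in> ?G" by blast
    then show "{x \<in> space (sigma UNIV ?G). x t \<le> a} \<in> sets (sigma UNIV ?G)"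
      by (simp add: orthant_single[symmetric])
  qed
  have "(\<lambda>x. x) \<in> measurable (sigma UNIV ?G) path_space"
    by (rule measurable_path_spaceI) (rule *)
  then have "A \<in> sets (sigma UNIV ?G)" if "A \<in> sets path_space" for A
    using measurable_sets[of "\<lambda>x. x" "sigma UNIV ?G" path_space A] that by simp
  then show "sets path_space \<subseteq> sigma_sets UNIV ?G" by (simp add: subset_iff)
qed

section \<open>Max-infinitely divisible laws\<close>

text \<open>Maxima see the law only through its distribution functions: for independent copies with law
  \<open>K\<close>, the probability that the maximum lies in an orthant is the power of that for one copy.\<close>

locale max_id_law = prob_space L for L :: "(int \<Rightarrow> real) measure" +
  assumes sets_L [measurable_cong]: "sets L = sets path_space"
    and roots: "\<And>n::nat. 1 \<le> n \<Longrightarrow> \<exists>K. prob_space K \<and> sets K = sets path_space \<and>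
      (\<forall>S. finite S \<longrightarrow> measure L (orthant S) = measure K (orthant S) ^ n)"
begin

lemma space_L [simp]: "space L = UNIV"
  using sets_eq_imp_space_eq[OF sets_L] by simp

text \<open>The root has order \<open>Suc n\<close>, so that it exists for every index.\<close>

definition max_root :: "nat \<Rightarrow> (int \<Rightarrow> real) measure" where
  "max_root n = (SOME K. prob_space K \<and> sets K = sets path_space \<and>
      (\<forall>S. finite S \<longrightarrow> measure L (orthant S) = measure K (orthant S) ^ Suc n))"

lemma
  shows prob_space_root: "prob_space (max_root n)"
    and sets_root: "sets (max_root n) = sets path_space"
    and root_orthant: "finite S \<Longrightarrow> prob (orthant S) = measure (max_root n) (orthant S) ^ Suc n"
proof -
  have "prob_space (max_root n) \<and> sets (max_root n) = sets path_space \<and>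
      (\<forall>S. finite S \<longrightarrow> prob (orthant S) = measure (max_root n) (orthant S) ^ Suc n)"
    unfolding max_root_def by (rule someI_ex, rule roots) simp
  then show "prob_space (max_root n)" "sets (max_root n) = sets path_space"
    "finite S \<Longrightarrow> prob (orthant S) = measure (max_root n) (orthant S) ^ Suc n"
    by blast+
qed

text \<open>In terms of the exponent measure of the law, this is the mass of the paths that leave both
  orthants.\<close>

definition redundancy :: "(int \<times> real) set \<Rightarrow> (int \<times> real) set \<Rightarrow> real" where
  "redundancy S S' = ln (prob (orthant (S \<union> S'))) - ln (prob (orthant S)) - ln (prob (orthant S'))"

definition exceedance_mass :: "nat \<Rightarrow> (int \<times> real) set \<Rightarrow> (int \<times> real) set \<Rightarrow> real" where
  "exceedance_mass n S S' = real (Suc n) * measure (max_root n) (- orthant S \<inter> - orthant S')"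

lemma root_orthant_exp:
  assumes "finite S" "0 < prob (orthant S)"
  shows "measure (max_root n) (orthant S) = exp (ln (prob (orthant S)) / real (Suc n))"
proof -
  define x where "x = measure (max_root n) (orthant S)"
  have p: "prob (orthant S) = x ^ Suc n"
    unfolding x_def by (rule root_orthant[OF assms(1)])
  have "x \<noteq> 0" using assms(2) unfolding p by (auto simp del: power_Suc)
  then have x: "0 < x" unfolding x_def by (simp add: zero_less_measure_iff)
  then have "ln (prob (orthant S)) / real (Suc n) = ln x"
    unfolding p ln_realpow by (simp del: of_nat_Suc)
  with x show ?thesis unfolding x_def by simp
qed

text \<open>The \<open>n\<close>-th root of \<open>p > 0\<close> is \<open>exp (ln p / n)\<close>, and \<open>exp\<close> has slope \<open>1\<close> at \<open>0\<close>.\<close>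

lemma root_Compl_tendsto:
  assumes "finite S" "0 < prob (orthant S)"
  shows "(\<lambda>n. real (Suc n) * (1 - measure (max_root n) (orthant S))) \<longlonglongrightarrow> - ln (prob (orthant S))"
proof -
  define c where "c = ln (prob (orthant S))"
  have "(\<lambda>n. real (Suc n) * (1 - exp (c / real (Suc n)))) \<longlonglongrightarrow> - c"
    by real_asymp
  then show ?thesis unfolding root_orthant_exp[OF assms] c_def .
qed

lemma root_Compl_Int_Compl:
  assumes "finite S" "finite S'"
  shows "measure (max_root n) (- orthant S \<inter> - orthant S')
    = (1 - measure (max_root n) (orthant S)) + (1 - measure (max_root n) (orthant S'))
      - (1 - measure (max_root n) (orthant (S \<union> S')))"
proof -
  interpret K: prob_space "max_root n" by (rule prob_space_root)
  have sp: "space (max_root n) = UNIV"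
    using sets_eq_imp_space_eq[OF sets_root] by simp
  have ev: "orthant S \<in> K.events" "orthant S' \<in> K.events"
    using assms by (simp_all add: sets_root)
  have "K.prob (- orthant S \<inter> - orthant S') = 1 - K.prob (orthant S \<union> orthant S')"
    using K.prob_compl[of "orthant S \<union> orthant S'"] ev by (simp add: sp Compl_eq_Diff_UNIV[symmetric])
  moreover have "K.prob (orthant S \<union> orthant S')
      = K.prob (orthant S) + K.prob (orthant S') - K.prob (orthant S \<inter> orthant S')"
    using measure_Un3[of "orthant S" "max_root n" "orthant S'"] ev
    by (simp add: K.fmeasurable_eq_sets)
  ultimately show ?thesis by (simp add: orthant_Un)
qed

text \<open>Two events of positive probability need not meet, but for a high root both orthants have
  probability above \<open>1/2\<close>, and then they do.\<close>

lemma prob_orthant_Un_pos: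
  assumes "finite S" "finite S'" "0 < prob (orthant S)" "0 < prob (orthant S')"
  shows "0 < prob (orthant (S \<union> S'))"
proof -
  have half: "\<forall>\<^sub>F n in sequentially. 1 / 2 < measure (max_root n) (orthant S)"
    if "finite S" "0 < prob (orthant S)" for S
  proof -
    define c where "c = ln (prob (orthant S))"
    have "\<forall>\<^sub>F n in sequentially. 1 / 2 < exp (c / real (Suc n))"
      by real_asymp
    then show ?thesis unfolding root_orthant_exp[OF that] c_def .
  qed
  obtain n where "1 / 2 < measure (max_root n) (orthant S)"
    "1 / 2 < measure (max_root n) (orthant S')"
    using eventually_happens[OF eventually_conj[OF half[OF assms(1,3)] half[OF assms(2,4)]]] by auto
  then have "0 < measure (max_root n) (orthant (S \<union> S'))"
    using root_Compl_Int_Compl[OF assms(1,2), of n]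
      measure_nonneg[of "max_root n" "- orthant S \<inter> - orthant S'"] by linarith
  then show ?thesis
    using root_orthant[of "S \<union> S'" n] assms by simp
qed

lemma exceedance_mass_tendsto:
  assumes "finite S" "finite S'" "0 < prob (orthant S)" "0 < prob (orthant S')"
  shows "(\<lambda>n. exceedance_mass n S S') \<longlonglongrightarrow> redundancy S S'"
proof -
  have "(\<lambda>n. real (Suc n) * (1 - measure (max_root n) (orthant S))
      + real (Suc n) * (1 - measure (max_root n) (orthant S'))
      - real (Suc n) * (1 - measure (max_root n) (orthant (S \<union> S'))))
    \<longlonglongrightarrow> - ln (prob (orthant S)) + - ln (prob (orthant S')) - - ln (prob (orthant (S \<union> S')))"
    using assms prob_orthant_Un_pos[OF assms]
    by (intro tendsto_diff tendsto_add root_Compl_tendsto) simp_all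
  moreover have "- ln (prob (orthant S)) + - ln (prob (orthant S')) - - ln (prob (orthant (S \<union> S')))
      = redundancy S S'"
    by (simp add: redundancy_def)
  ultimately show ?thesis
    unfolding exceedance_mass_def root_Compl_Int_Compl[OF assms(1,2)]
    by (simp only: right_diff_distrib distrib_left)
qed

lemma redundancy_nonneg:
  assumes "finite S" "finite S'" "0 < prob (orthant S)" "0 < prob (orthant S')"
  shows "0 \<le> redundancy S S'"
  by (rule LIMSEQ_le_const[OF exceedance_mass_tendsto[OF assms]]) (simp add: exceedance_mass_def)

text \<open>A path that leaves both orthants exceeds the common lower level \<open>a\<close> at some time of \<open>S\<close> and at
  some time of \<open>S'\<close>, so the union bound for the exceedance masses passes to the limit.\<close>

lemma redundancy_le_sum:
  assumes "finite S" "finite S'" "0 < prob (orthant S)" "0 < prob (orthant S')"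
    and a: "\<And>t b. (t, b) \<in> S \<union> S' \<Longrightarrow> a \<le> b"
    and pos: "\<And>t. 0 < prob (orthant {(t, a)})"
  shows "redundancy S S' \<le> (\<Sum>p\<in>S. \<Sum>q\<in>S'. redundancy {(fst p, a)} {(fst q, a)})"
proof (rule LIMSEQ_le[OF exceedance_mass_tendsto[OF assms(1-4)]])
  show "(\<lambda>n. \<Sum>p\<in>S. \<Sum>q\<in>S'. exceedance_mass n {(fst p, a)} {(fst q, a)})
      \<longlonglongrightarrow> (\<Sum>p\<in>S. \<Sum>q\<in>S'. redundancy {(fst p, a)} {(fst q, a)})"
    by (intro tendsto_sum exceedance_mass_tendsto pos) simp_all
  have "exceedance_mass n S S' \<le> (\<Sum>p\<in>S. \<Sum>q\<in>S'. exceedance_mass n {(fst p, a)} {(fst q, a)})" for n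
  proof -
    interpret K: prob_space "max_root n" by (rule prob_space_root)
    let ?F = "\<lambda>p q. - orthant {(fst p, a)} \<inter> - orthant {(fst q, a)}"
    have "orthant {(fst p, a)} \<in> K.events" for p :: "int \<times> real"
      by (simp add: sets_root)
    moreover have "space (max_root n) = UNIV"
      using sets_eq_imp_space_eq[OF sets_root] by simp
    ultimately have ev: "?F p q \<in> K.events" for p q :: "int \<times> real"
      using sets.compl_sets[of _ "max_root n"] by (auto simp: Compl_eq_Diff_UNIV)
    have "K.prob (- orthant S \<inter> - orthant S') \<le> K.prob (\<Union>p\<in>S. \<Union>q\<in>S'. ?F p q)"
    proof (rule K.finite_measure_mono)
      show "- orthant S \<inter> - orthant S' \<subseteq> (\<Union>p\<in>S. \<Union>q\<in>S'. ?F p q)"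
      proof
        fix x assume x: "x \<in> - orthant S \<inter> - orthant S'"
        have exceed: "\<exists>p\<in>R. x \<in> - orthant {(fst p, a)}" if R: "R \<subseteq> S \<union> S'" "x \<notin> orthant R" for R
        proof -
          obtain t b where "(t, b) \<in> R" "\<not> x t \<le> b"
            using R(2) unfolding orthant_def by blast
          moreover from this have "a \<le> b" using R(1) a by blast
          ultimately show ?thesis
            by (intro bexI[of _ "(t, b)"]) (auto simp: orthant_single)
        qed
        have "\<exists>p\<in>S. x \<in> - orthant {(fst p, a)}" "\<exists>q\<in>S'. x \<in> - orthant {(fst q, a)}"
          using x by (intro exceed; simp)+
        then show "x \<in> (\<Union>p\<in>S. \<Union>q\<in>S'. ?F p q)" by blast
      qed
      show "(\<Union>p\<in>S. \<Union>q\<in>S'. ?F p q) \<in> K.events"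
        by (intro sets.finite_UN assms(1,2) ev)
    qed
    also have "\<dots> \<le> (\<Sum>p\<in>S. K.prob (\<Union>q\<in>S'. ?F p q))"
      by (intro K.finite_measure_subadditive_finite image_subsetI sets.finite_UN assms(1,2) ev)
    also have "\<dots> \<le> (\<Sum>p\<in>S. \<Sum>q\<in>S'. K.prob (?F p q))"
      by (intro sum_mono K.finite_measure_subadditive_finite image_subsetI assms(1,2) ev)
    finally show ?thesis
      unfolding exceedance_mass_def sum_distrib_left[symmetric]
      by (rule mult_left_mono) simp
  qed
  then show "\<exists>N. \<forall>n\<ge>N. exceedance_mass n S S'
      \<le> (\<Sum>p\<in>S. \<Sum>q\<in>S'. exceedance_mass n {(fst p, a)} {(fst q, a)})" by blast
qed

lemma prob_orthant_Un:
  assumes "finite S" "finite S'" "0 < prob (orthant S)" "0 < prob (orthant S')"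
  shows "prob (orthant (S \<union> S')) = prob (orthant S) * prob (orthant S') * exp (redundancy S S')"
  using assms prob_orthant_Un_pos[OF assms]
  by (simp add: redundancy_def exp_diff)

text \<open>With \<open>r\<close> the redundancy, \<open>q\<close> the joint probability and \<open>p\<close> the product of the two
  probabilities, \<open>q - p = q (1 - exp (- r))\<close>.\<close>

lemma decorrelation_le_redundancy:
  assumes "finite S" "finite S'" "0 < prob (orthant S)" "0 < prob (orthant S')"
  shows "decorrelation (orthant S) (orthant S') \<le> redundancy S S'"
proof -
  let ?q = "prob (orthant (S \<union> S'))" and ?p = "prob (orthant S) * prob (orthant S')"
    and ?r = "redundancy S S'"
  have "?p = ?q * exp (- ?r)"
    by (simp add: prob_orthant_Un[OF assms] exp_minus)
  then have eq: "?q - ?p = ?q * (1 - exp (- ?r))" by (simp add: algebra_simps)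
  have r: "0 \<le> 1 - exp (- ?r)" "1 - exp (- ?r) \<le> ?r"
    using redundancy_nonneg[OF assms] exp_ge_add_one_self[of "- ?r"] by auto
  have "?q - ?p \<ge> 0" "?q - ?p \<le> ?r"
    using r mult_left_le_one_le[OF r(1), of ?q] unfolding eq by auto
  then show ?thesis by (simp add: decorrelation_def orthant_Un)
qed

end

section \<open>Stationary max-infinitely divisible laws\<close>

locale stationary_max_id_law = max_id_law +
  assumes shift_invariant: "distr L path_space (shift h) = L"
begin

lemma measure_preserving_shift: "measure_preserving_maps L (\<lambda>t::nat. shift (int t))"
  unfolding measure_preserving_maps_def
proof (intro allI conjI)
  fix t :: nat
  show "shift (int t) \<in> measurable L L" by measurable
  show "distr L L (shift (int t)) = L"
    using shift_invariant[of "int t"] by (simp cong: distr_cong add: sets_L)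
qed

lemma prob_shift_vimage:
  assumes "D \<in> sets path_space"
  shows "prob (shift h -` D) = prob D"
proof -
  have "measure (distr L path_space (shift h)) D = prob (shift h -` D)"
    using assms by (subst measure_distr) simp_all
  then show ?thesis by (simp add: shift_invariant)
qed

lemma prob_orthant_shift:
  "finite S \<Longrightarrow> prob (orthant ((\<lambda>(t, a). (t + h, a)) ` S)) = prob (orthant S)"
  using prob_shift_vimage[of "orthant S" h] by (simp add: shift_vimage_orthant)

lemma prob_orthant_single: "prob (orthant {(t, a)}) = prob (orthant {(0, a)})"
  using prob_orthant_shift[of "{(0, a)}" t] by simp

text \<open>For the law of a process \<open>X\<close> this is \<open>tau M X a k\<close>.\<close>

definition lag_redundancy :: "real \<Rightarrow> int \<Rightarrow> real" where
  "lag_redundancy a k = redundancy {(0, a)} {(k, a)}"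

lemma redundancy_lag: "redundancy {(s, a)} {(t, a)} = lag_redundancy a (t - s)"
  using prob_orthant_shift[of "{(t - s, a), (0, a)}" s]
  by (simp add: lag_redundancy_def redundancy_def prob_orthant_single[of s] prob_orthant_single[of t]
      prob_orthant_single[of "t - s"])

lemma lag_redundancy_nonneg:
  assumes "0 < prob (orthant {(0, a)})"
  shows "0 \<le> lag_redundancy a k"
  unfolding lag_redundancy_def using assms
  by (intro redundancy_nonneg) (simp_all add: prob_orthant_single[of k])

lemma lag_redundancy_le:
  assumes "0 < prob (orthant {(0, a)})"
  shows "lag_redundancy a k \<le> - ln (prob (orthant {(0, a)}))"
proof -
  have "prob (orthant ({(0, a)} \<union> {(k, a)})) \<le> prob (orthant {(0, a)})"
    by (intro finite_measure_mono orthant_antimono) (auto simp: sets_L)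
  moreover have "0 < prob (orthant ({(0, a)} \<union> {(k, a)}))"
    using assms by (intro prob_orthant_Un_pos) (simp_all add: prob_orthant_single[of k])
  ultimately have "ln (prob (orthant ({(0, a)} \<union> {(k, a)}))) \<le> ln (prob (orthant {(0, a)}))"
    using assms by (simp only: ln_le_cancel_iff)
  then show ?thesis
    unfolding lag_redundancy_def redundancy_def prob_orthant_single[of k] by linarith
qed

text \<open>After the shift by \<open>t\<close>, the constraints \<open>p \<in> S\<close> and \<open>q \<in> S'\<close> are separated by the lag
  \<open>t + (fst q - fst p)\<close>, which runs through a shifted copy of the lags in the hypothesis.\<close>

lemma cesaro_null_decorrelation_high_orthants:
  assumes "finite S" "finite S'"
    and levels: "\<And>t b. (t, b) \<in> S \<union> S' \<Longrightarrow> a \<le> b"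
    and pos: "0 < prob (orthant {(0, a)})"
    and null: "cesaro_null (\<lambda>t. lag_redundancy a (int t))"
  shows "cesaro_null (\<lambda>t. decorrelation (orthant S) (shift (int t) -` orthant S'))"
proof (rule cesaro_null_mono)
  have pos1: "0 < prob (orthant {(t, a)})" for t
    using pos by (simp add: prob_orthant_single[of t])
  have pos2: "0 < prob (orthant S)" if "finite S" "\<And>t b. (t, b) \<in> S \<Longrightarrow> a \<le> b" for S
    using that
  proof (induction S rule: finite_induct)
    case empty
    then show ?case using prob_space by (simp add: orthant_def)
  next
    case (insert p S)
    obtain t b where p: "p = (t, b)" by fastforce
    have "prob (orthant {(t, a)}) \<le> prob (orthant {p})"
    proof (rule finite_measure_mono)
      have "a \<le> b" using insert.prems p by blast
      then show "orthant {(t, a)} \<subseteq> orthant {p}" by (auto simp: orthant_def p)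
    qed (simp add: sets_L)
    with pos1[of t] have "0 < prob (orthant ({p} \<union> S))"
      using insert by (intro prob_orthant_Un_pos) (auto intro: less_le_trans)
    then show ?case by simp
  qed
  show "cesaro_null (\<lambda>t. \<Sum>p\<in>S. \<Sum>q\<in>S'. lag_redundancy a (int t + (fst q - fst p)))"
    using lag_redundancy_nonneg[OF pos] lag_redundancy_le[OF pos]
    by (intro cesaro_null_sum cesaro_null_shift[OF null, where B = "- ln (prob (orthant {(0, a)}))"])
       (simp add: abs_of_nonneg)
  fix t :: nat
  let ?sh = "\<lambda>(s, b). (s + int t, b)"
  have "decorrelation (orthant S) (shift (int t) -` orthant S') \<le> redundancy S (?sh ` S')"
    unfolding shift_vimage_orthant using assms
    by (intro decorrelation_le_redundancy pos2) auto
  also have "\<dots> \<le> (\<Sum>p\<in>S. \<Sum>q\<in>?sh ` S'. redundancy {(fst p, a)} {(fst q, a)})"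
    using assms pos1 by (intro redundancy_le_sum pos2) auto
  also have "\<dots> = (\<Sum>p\<in>S. \<Sum>q\<in>S'. lag_redundancy a (int t + (fst q - fst p)))"
  proof (rule sum.cong[OF refl])
    fix p :: "int \<times> real"
    have "inj_on ?sh S'" by (auto simp: inj_on_def)
    then show "(\<Sum>q\<in>?sh ` S'. redundancy {(fst p, a)} {(fst q, a)})
        = (\<Sum>q\<in>S'. lag_redundancy a (int t + (fst q - fst p)))"
      unfolding sum.reindex[OF \<open>inj_on ?sh S'\<close>] redundancy_lag
      by (simp add: o_def case_prod_beta algebra_simps)
  qed
  finally show "decorrelation (orthant S) (shift (int t) -` orthant S')
      \<le> (\<Sum>p\<in>S. \<Sum>q\<in>S'. lag_redundancy a (int t + (fst q - fst p)))" .
qed simp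

lemma orthant_raise_tendsto:
  assumes "finite S"
  shows "(\<lambda>m. prob (orthant ((\<lambda>(t, b). (t, b + 1 / real (Suc m))) ` S))) \<longlonglongrightarrow> prob (orthant S)"
proof -
  let ?R = "\<lambda>m. orthant ((\<lambda>(t, b). (t, b + 1 / real (Suc m))) ` S)"
  have "(\<lambda>m. prob (?R m)) \<longlonglongrightarrow> prob (\<Inter>m. ?R m)"
  proof (rule finite_Lim_measure_decseq)
    show "range ?R \<subseteq> events" using assms by (auto simp: sets_L)
    show "decseq ?R"
    proof (rule decseq_SucI)
      fix m
      have "1 / real (Suc (Suc m)) \<le> 1 / real (Suc m)" by (simp add: frac_le)
      then show "?R (Suc m) \<subseteq> ?R m" by (fastforce simp: orthant_def)
    qed
  qed
  moreover have "(\<Inter>m. ?R m) = orthant S"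
  proof
    show "orthant S \<subseteq> (\<Inter>m. ?R m)"
      by (fastforce simp: orthant_def intro: order_trans)
    show "(\<Inter>m. ?R m) \<subseteq> orthant S"
    proof
      fix x assume x: "x \<in> (\<Inter>m. ?R m)"
      have "x t \<le> b" if "(t, b) \<in> S" for t b
      proof (rule LIMSEQ_le_const)
        show "(\<lambda>m. b + 1 / real (Suc m)) \<longlonglongrightarrow> b" by real_asymp
        show "\<exists>N. \<forall>m\<ge>N. x t \<le> b + 1 / real (Suc m)"
          using x that by (force simp: orthant_def)
      qed
      then show "x \<in> orthant S" by (auto simp: orthant_def)
    qed
  qed
  ultimately show ?thesis by simp
qed

text \<open>The hypothesis on the lag redundancies is required only at levels \<open>a\<close> that lie strictly above
  some level \<open>b\<close> of positive probability. An orthant of positive probability may have the lowest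
  possible level itself, when the one-dimensional distribution has an atom at its essential
  infimum; raising all levels by \<open>1 / (m + 1)\<close> avoids this.\<close>

lemma cesaro_null_decorrelation_orthants:
  assumes "finite S" "finite S'"
    and null: "\<And>a b. b < a \<Longrightarrow> 0 < prob (orthant {(0, b)}) \<Longrightarrow> cesaro_null (\<lambda>t. lag_redundancy a (int t))"
  shows "cesaro_null (\<lambda>t. decorrelation (orthant S) (shift (int t) -` orthant S'))"
proof (cases "S \<union> S' = {} \<or> prob (orthant S) = 0 \<or> prob (orthant S') = 0")
  case True
  have ev: "orthant S \<in> events" "shift (int t) -` orthant S' \<in> events" for t :: nat
    using assms preimage_event[OF measure_preserving_shift, of "orthant S'" t] by (auto simp: sets_L)
  have inv: "prob (shift (int t) -` orthant S') = prob (orthant S')" for t :: nat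
    using assms by (simp add: prob_shift_vimage)
  have "decorrelation (orthant S) (shift (int t) -` orthant S') = 0" for t :: nat
    using True
  proof (elim disjE)
    assume "S \<union> S' = {}"
    then show ?thesis using prob_space by (simp add: orthant_def decorrelation_def)
  next
    assume "prob (orthant S) = 0"
    then show ?thesis using ev by (intro decorrelation_null_set)
  next
    assume "prob (orthant S') = 0"
    then show ?thesis using ev inv
      by (subst decorrelation_commute, intro decorrelation_null_set) simp_all
  qed
  then show ?thesis by simp
next
  case False
  let ?raise = "\<lambda>m. (\<lambda>(t, b). (t, b + 1 / real (Suc m)))"
  have posb: "0 < prob (orthant {(0, b)})" if "(t, b) \<in> S \<union> S'" for t b
  proof -
    have "\<exists>S''\<in>{S, S'}. (t, b) \<in> S''" using that by auto
    then obtain S'' where S'': "S'' \<in> {S, S'}" "(t, b) \<in> S''" by blast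
    have "prob (orthant S'') \<le> prob (orthant {(t, b)})"
      using S'' assms by (intro finite_measure_mono orthant_antimono) (auto simp: sets_L)
    moreover have "0 < prob (orthant S'')"
      using False S'' by (auto simp: zero_less_measure_iff)
    ultimately show ?thesis by (simp add: prob_orthant_single[of t])
  qed
  define b where "b = Min (snd ` (S \<union> S'))"
  have "b \<in> snd ` (S \<union> S')"
    unfolding b_def using assms False by (intro Min_in) auto
  then obtain t where "(t, b) \<in> S \<union> S'" by force
  then have b: "0 < prob (orthant {(0, b)})" by (rule posb)
  have b_le: "b \<le> c" if "(t, c) \<in> S \<union> S'" for t c
  proof -
    have "c \<in> snd ` (S \<union> S')" using that by (intro image_eqI[of _ _ "(t, c)"]) simp_all
    then show ?thesis unfolding b_def using assms by (intro Min_le) simp_all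
  qed
  \<comment> \<open>The two orthants are raised by different amounts, because they are let down again one after
    the other.\<close>
  have raised: "cesaro_null (\<lambda>t. decorrelation (orthant (?raise m ` S)) (shift (int t) -` orthant (?raise m' ` S')))"
    for m m'
  proof -
    define a where "a = b + min (1 / real (Suc m)) (1 / real (Suc m'))"
    have "b < a" by (simp add: a_def)
    have "0 < prob (orthant {(0, a)})"
    proof (rule less_le_trans[OF b], rule finite_measure_mono)
      show "orthant {(0, b)} \<subseteq> orthant {(0, a)}" using \<open>b < a\<close> by (auto simp: orthant_def)
    qed (simp add: sets_L)
    moreover have "a \<le> c" if "(t, c) \<in> ?raise m ` S \<union> ?raise m' ` S'" for t c
      using that b_le by (fastforce simp: a_def)
    ultimately show ?thesis
      by (intro cesaro_null_decorrelation_high_orthants[where a = a] finite_imageI assms(1,2)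
          null[OF \<open>b < a\<close> b])
  qed
  have near: "\<exists>m. \<bar>prob (orthant S) - prob (orthant (?raise m ` S))\<bar> < e"
    if "finite S" "0 < e" for S e
    using LIMSEQ_D[OF orthant_raise_tendsto[OF that(1)] that(2)]
    by (auto simp: abs_minus_commute)
  have sup: "orthant S \<subseteq> orthant (?raise m ` S)" for S m
    by (fastforce simp: orthant_def intro: order_trans)
  have id: "measure_preserving_maps L (\<lambda>t::nat. \<lambda>x. x)"
    by (simp add: measure_preserving_maps_def distr_id2)
  have left: "cesaro_null (\<lambda>t. decorrelation (orthant S) (shift (int t) -` orthant (?raise m' ` S')))" for m'
  proof -
    have "cesaro_null (\<lambda>t. decorrelation ((\<lambda>x. x) -` orthant S \<inter> space L)
        (shift (int t) -` orthant (?raise m' ` S')))"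
    proof (rule cesaro_null_decorrelation_approx[OF id])
      fix e :: real assume "0 < e"
      with near[OF assms(1)] obtain m where "\<bar>prob (orthant S) - prob (orthant (?raise m ` S))\<bar> < e"
        by blast
      then show "\<exists>D\<in>events. (D \<subseteq> orthant S \<or> orthant S \<subseteq> D) \<and> \<bar>prob (orthant S) - prob D\<bar> < e \<and>
          cesaro_null (\<lambda>t. decorrelation ((\<lambda>x. x) -` D \<inter> space L) (shift (int t) -` orthant (?raise m' ` S')))"
        using raised[of m m'] sup[of S m] assms(1)
        by (intro bexI[of _ "orthant (?raise m ` S)"]) (auto simp: sets_L)
    qed (use assms preimage_event[OF measure_preserving_shift] in \<open>auto simp: sets_L shift_vimage_orthant\<close>)
    then show ?thesis by simp
  qed
  have "cesaro_null (\<lambda>t. decorrelation (shift (int t) -` orthant S' \<inter> space L) (orthant S))"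
  proof (rule cesaro_null_decorrelation_approx[OF measure_preserving_shift])
    fix e :: real assume "0 < e"
    with near[OF assms(2)] obtain m where "\<bar>prob (orthant S') - prob (orthant (?raise m ` S'))\<bar> < e"
      by blast
    then show "\<exists>D\<in>events. (D \<subseteq> orthant S' \<or> orthant S' \<subseteq> D) \<and> \<bar>prob (orthant S') - prob D\<bar> < e \<and>
        cesaro_null (\<lambda>t. decorrelation (shift (int t) -` D \<inter> space L) (orthant S))"
      using left[of m] sup[of S' m] assms(2)
      by (intro bexI[of _ "orthant (?raise m ` S')"]) (auto simp: sets_L decorrelation_commute)
  qed (use assms in \<open>auto simp: sets_L\<close>)
  then show ?thesis by (simp add: decorrelation_commute)
qed

lemma cesaro_null_decorrelation:
  assumes null: "\<And>a b. b < a \<Longrightarrow> 0 < prob (orthant {(0, b)}) \<Longrightarrow> cesaro_null (\<lambda>t. lag_redundancy a (int t))"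
    and "C \<in> sets path_space" "D \<in> sets path_space"
  shows "cesaro_null (\<lambda>t. decorrelation C (shift (int t) -` D))"
proof -
  have "cesaro_null (\<lambda>t. decorrelation C (shift (int t) -` D \<inter> space L))"
  proof (rule cesaro_null_decorrelation_generator[OF measure_preserving_shift Int_stable_orthants])
    show "events = sigma_sets (space L) {orthant S | S. finite S}"
      by (simp add: sets_L sets_path_space_orthants)
    show "cesaro_null (\<lambda>t. decorrelation C (shift (int t) -` D \<inter> space L))"
      if "C \<in> {orthant S | S. finite S}" "D \<in> {orthant S | S. finite S}" for C D
      using that cesaro_null_decorrelation_orthants[OF _ _ null] by auto
  qed (use assms in \<open>auto simp: sets_L\<close>)
  then show ?thesis by simp
qed

text \<open>The joint probability is at least the product of the marginal ones, because the redundancies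
  are nonnegative, so convergence of its averages already forces its excess to be small; and the
  redundancies are bounded by that excess through \<open>x \<le> exp x - 1\<close>.\<close>

lemma cesaro_null_lag_redundancy:
  assumes pos: "0 < prob (orthant {(0, a)})"
    and erg: "(\<lambda>n. (1 / real n) * (\<Sum>t=1..n. prob (orthant {(0, a)} \<inter> shift (int t) -` orthant {(0, a)})))
      \<longlonglongrightarrow> prob (orthant {(0, a)}) * prob (orthant {(0, a)})"
  shows "cesaro_null (\<lambda>t. lag_redundancy a (int t))"
proof -
  let ?p = "prob (orthant {(0, a)})"
  let ?q = "\<lambda>t::nat. prob (orthant {(0, a)} \<inter> shift (int t) -` orthant {(0, a)})"
  have q: "?q t = ?p * ?p * exp (lag_redundancy a (int t))" for t :: nat
    using prob_orthant_Un[of "{(0, a)}" "{(int t, a)}"] pos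
    by (simp add: shift_vimage_orthant orthant_Un[symmetric] lag_redundancy_def
        prob_orthant_single[of "int t"] del: Un_insert_left Un_insert_right)
  show ?thesis
  proof (rule cesaro_null_mono)
    fix t :: nat
    show "0 \<le> lag_redundancy a (int t)" by (rule lag_redundancy_nonneg[OF pos])
    show "lag_redundancy a (int t) \<le> ?q t / (?p * ?p) - 1"
      using exp_ge_add_one_self[of "lag_redundancy a (int t)"] pos unfolding q by (simp add: algebra_simps)
  next
    have "(\<lambda>n. ((1 / real n) * (\<Sum>t=1..n. ?q t)) / (?p * ?p) - 1) \<longlonglongrightarrow> (?p * ?p) / (?p * ?p) - 1"
      using pos by (intro tendsto_intros erg) simp
    then have "(\<lambda>n. ((1 / real n) * (\<Sum>t=1..n. ?q t)) / (?p * ?p) - 1) \<longlonglongrightarrow> 0"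
      using pos by simp
    then show "cesaro_null (\<lambda>t. ?q t / (?p * ?p) - 1)"
      unfolding cesaro_null_def
    proof (rule Lim_transform_eventually)
      show "\<forall>\<^sub>F n in sequentially. ((1 / real n) * (\<Sum>t=1..n. ?q t)) / (?p * ?p) - 1
          = (1 / real n) * (\<Sum>t=1..n. ?q t / (?p * ?p) - 1)"
        using eventually_gt_at_top[of 0]
        by eventually_elim (simp add: sum_subtractf sum_divide_distrib[symmetric] field_simps)
    qed
  qed
qed

end

section \<open>Processes and their laws\<close>

lemma path_measurable:
  assumes "\<And>t. X t \<in> borel_measurable M"
  shows "(\<lambda>\<omega> t. X t \<omega>) \<in> measurable M path_space"
  using assms by (intro measurable_path_spaceI)

lemma measure_process_law:
  assumes "\<And>t. X t \<in> borel_measurable M" "C \<in> sets path_space"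
  shows "measure (process_law M X) C = measure M {\<omega> \<in> space M. (\<lambda>t. X t \<omega>) \<in> C}"
  unfolding process_law_def
  by (subst measure_distr[OF path_measurable[OF assms(1)] assms(2)])
     (auto intro!: arg_cong[where f = "measure M"])

lemma stationary_process_law:
  assumes X: "\<And>t. X t \<in> borel_measurable M" and "stationary M X"
  shows "distr (process_law M X) path_space (shift h) = process_law M X"
proof -
  have "distr (process_law M X) path_space (shift h) = process_law M (\<lambda>t. X (t + h))"
    unfolding process_law_def
    by (subst distr_distr[OF shift_measurable path_measurable[OF X]]) (simp add: o_def shift_def)
  then show ?thesis using assms(2) by (simp add: stationary_def)
qed

text \<open>The maximum lies in an orthant exactly if each of the \<open>n\<close> independent copies does.\<close>

lemma max_infinitely_divisible_roots:
  assumes "max_infinitely_divisible M X" "1 \<le> n"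
  shows "\<exists>K. prob_space K \<and> sets K = sets path_space \<and>
    (\<forall>S. finite S \<longrightarrow> measure (process_law M X) (orthant S) = measure K (orthant S) ^ n)"
proof -
  obtain N :: "(nat \<Rightarrow> int \<Rightarrow> real) measure" and Y :: "nat \<Rightarrow> int \<Rightarrow> _ \<Rightarrow> real" where
    N: "prob_space N"
    and ind: "prob_space.indep_vars N (\<lambda>_. path_space) (\<lambda>i \<omega> t. Y i t \<omega>) {..<n}"
    and iid: "\<And>i. i < n \<Longrightarrow> process_law N (Y i) = process_law N (Y 0)"
    and law: "process_law M X = process_law N (\<lambda>t \<omega>. Max ((\<lambda>i. Y i t \<omega>) ` {..<n}))"
    using assms unfolding max_infinitely_divisible_def by metis
  interpret N: prob_space N by (rule N)
  have Ym: "(\<lambda>\<omega> t. Y i t \<omega>) \<in> measurable N path_space" if "i < n" for i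
    using ind that unfolding N.indep_vars_def by auto
  have Y: "Y i t \<in> borel_measurable N" if "i < n" for i t
    using measurable_compose[OF Ym[OF that] coordinate_measurable[of t]] by simp
  have ne: "{..<n} \<noteq> {}" using assms(2) by (simp add: lessThan_empty_iff)
  have Max: "(\<lambda>\<omega>. Max ((\<lambda>i. Y i t \<omega>) ` {..<n})) \<in> borel_measurable N" for t
    using Y by (intro borel_measurable_Max) auto
  have Max_le: "Max ((\<lambda>i. Y i t \<omega>) ` {..<n}) \<le> b \<longleftrightarrow> (\<forall>i<n. Y i t \<omega> \<le> b)" for t \<omega> b
    using ne by (subst Max_le_iff) auto
  have Max_orthant: "(\<lambda>t. Max ((\<lambda>i. Y i t \<omega>) ` {..<n})) \<in> orthant S \<longleftrightarrow>
      (\<forall>i<n. (\<lambda>t. Y i t \<omega>) \<in> orthant S)" for \<omega> S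
    by (simp add: orthant_def case_prod_beta Max_le) blast
  have "measure (process_law M X) (orthant S) = measure (process_law N (Y 0)) (orthant S) ^ n"
    if S: "finite S" for S
  proof -
    let ?E = "\<lambda>i. (\<lambda>\<omega> t. Y i t \<omega>) -` orthant S \<inter> space N"
    have "measure (process_law M X) (orthant S)
        = N.prob {\<omega> \<in> space N. (\<lambda>t. Max ((\<lambda>i. Y i t \<omega>) ` {..<n})) \<in> orthant S}"
      unfolding law using measure_process_law[OF Max orthant_in_sets[OF S]] .
    also have "{\<omega> \<in> space N. (\<lambda>t. Max ((\<lambda>i. Y i t \<omega>) ` {..<n})) \<in> orthant S} = (\<Inter>i\<in>{..<n}. ?E i)"
      using ne by (auto simp: Max_orthant)
    also have "N.prob \<dots> = (\<Prod>i<n. N.prob (?E i))"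
      using ne S by (intro N.indep_varsD[OF ind]) auto
    also have "\<dots> = (\<Prod>i<n. measure (process_law N (Y 0)) (orthant S))"
    proof (rule prod.cong)
      fix i assume "i \<in> {..<n}"
      then have i: "i < n" by simp
      have "measure (process_law N (Y i)) (orthant S) = N.prob (?E i)"
        unfolding process_law_def by (rule measure_distr[OF Ym[OF i] orthant_in_sets[OF S]])
      then show "N.prob (?E i) = measure (process_law N (Y 0)) (orthant S)"
        by (simp add: iid[OF i])
    qed simp
    finally show ?thesis by simp
  qed
  moreover have "prob_space (process_law N (Y 0))"
    unfolding process_law_def using Ym[of 0] assms(2) by (intro N.prob_space_distr) auto
  ultimately show ?thesis
    by (intro exI[of _ "process_law N (Y 0)"]) (simp add: process_law_def)
qed

lemma (in prob_space) prob_le_pos_of_essinf_less: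
  assumes "f \<in> borel_measurable M" "essinf M f < ereal a"
  shows "0 < prob {\<omega> \<in> space M. f \<omega> \<le> a}"
proof (rule ccontr)
  assume "\<not> ?thesis"
  then have "prob {\<omega> \<in> space M. f \<omega> \<le> a} = 0"
    by (simp add: zero_less_measure_iff)
  then have "AE \<omega> in M. \<not> f \<omega> \<le> a"
    using assms(1) by (subst (asm) prob_eq_0) auto
  then have "AE \<omega> in M. ereal a \<le> ereal (f \<omega>)" by eventually_elim simp
  then have "ereal a \<le> essinf M f" unfolding essinf_def by (intro Sup_upper) simp
  with assms(2) show False by simp
qed

lemma (in prob_space) essinf_le_of_prob_le_pos:
  assumes "f \<in> borel_measurable M" "0 < prob {\<omega> \<in> space M. f \<omega> \<le> a}"
  shows "essinf M f \<le> ereal a"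
  unfolding essinf_def
proof (rule Sup_least)
  fix z assume "z \<in> {z. AE \<omega> in M. z \<le> ereal (f \<omega>)}"
  then have z: "AE \<omega> in M. z \<le> ereal (f \<omega>)" by simp
  show "z \<le> ereal a"
  proof (rule ccontr)
    assume "\<not> z \<le> ereal a"
    have "\<not> f \<omega> \<le> a" if "z \<le> ereal (f \<omega>)" for \<omega>
      using that \<open>\<not> z \<le> ereal a\<close> order_trans[of z "ereal (f \<omega>)" "ereal a"] by auto
    with z have "AE \<omega> in M. \<not> f \<omega> \<le> a"
      by (rule eventually_mono)
    then have "prob {\<omega> \<in> space M. f \<omega> \<le> a} = 0"
      using assms(1) by (subst prob_eq_0) auto
    with assms(2) show False by simp
  qed
qed

theorem theorem1p2:
  fixes M :: "'a measure" and X :: "int \<Rightarrow> 'a \<Rightarrow> real"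
  assumes "prob_space M"
    and "\<And>t. X t \<in> borel_measurable M"
    and "stationary M X"
    and "max_infinitely_divisible M X"
  shows "(ergodic_process M X \<longleftrightarrow> weakly_mixing_process M X) \<and>
    (weakly_mixing_process M X \<longleftrightarrow>
      (\<forall>a::real. essinf M (X 0) < ereal a \<longrightarrow>
        (\<lambda>n. (1 / real n) * (\<Sum>t=1..n. tau M X a (int t))) \<longlonglongrightarrow> 0))"
proof -
  note X = assms(2)
  interpret M: prob_space M by fact
  define L where "L = process_law M X"
  interpret L: stationary_max_id_law L
  proof (intro stationary_max_id_law.intro max_id_law.intro max_id_law_axioms.intro
      stationary_max_id_law_axioms.intro)
    show "prob_space L"
      unfolding L_def process_law_def by (intro M.prob_space_distr path_measurable X)
    show "sets L = sets path_space" by (simp add: L_def process_law_def)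
    show "\<exists>K. prob_space K \<and> sets K = sets path_space \<and>
      (\<forall>S. finite S \<longrightarrow> measure L (orthant S) = measure K (orthant S) ^ n)" if "1 \<le> n" for n
      unfolding L_def by (rule max_infinitely_divisible_roots[OF assms(4) that])
    show "distr L path_space (shift h) = L" for h
      unfolding L_def by (rule stationary_process_law[OF X assms(3)])
  qed
  have L: "L.prob C = M.prob {\<omega> \<in> space M. (\<lambda>t. X t \<omega>) \<in> C}" if "C \<in> sets path_space" for C
    unfolding L_def by (rule measure_process_law[OF X that])
  have vim: "shift h -` D \<in> sets path_space" if "D \<in> sets path_space" for D h
    using measurable_sets[OF shift_measurable that, of h] by simp
  have ev0: "M.prob (shifted_event M X C 0) = L.prob C" if "C \<in> sets path_space" for C
    by (simp add: L[OF that] shifted_event_def)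
  have ev: "M.prob (shifted_event M X C 0 \<inter> shifted_event M X D t) = L.prob (C \<inter> shift t -` D)"
    if "C \<in> sets path_space" "D \<in> sets path_space" for C D t
    using that vim[OF that(2), of t]
    by (subst L) (auto simp: shifted_event_def shift_def intro!: arg_cong[where f = M.prob])
  have erg: "ergodic_process M X \<longleftrightarrow> (\<forall>C\<in>sets path_space. \<forall>D\<in>sets path_space.
      (\<lambda>n. (1 / real n) * (\<Sum>t=1..n. L.prob (C \<inter> shift (int t) -` D))) \<longlonglongrightarrow> L.prob C * L.prob D)"
    unfolding ergodic_process_def by (simp add: ev ev0)
  have mix: "weakly_mixing_process M X \<longleftrightarrow> (\<forall>C\<in>sets path_space. \<forall>D\<in>sets path_space.
      cesaro_null (\<lambda>t. L.decorrelation C (shift (int t) -` D)))"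
    unfolding weakly_mixing_process_def cesaro_null_def L.decorrelation_def
    by (simp add: ev ev0 L.prob_shift_vimage)
  have pos: "L.prob (orthant {(t, a)}) = M.prob {\<omega> \<in> space M. X t \<omega> \<le> a}" for t a
    using L[OF orthant_in_sets, of "{(t, a)}"] by (simp add: orthant_single)
  have tau: "tau M X a t = L.lag_redundancy a t" for a t
  proof -
    have "L.prob (orthant ({(0, a)} \<union> {(t, a)})) = M.prob {\<omega> \<in> space M. X 0 \<omega> \<le> a \<and> X t \<omega> \<le> a}"
      using L[OF orthant_in_sets, of "{(0, a)} \<union> {(t, a)}"]
      unfolding orthant_Un orthant_single by simp
    then show ?thesis
      unfolding tau_def L.lag_redundancy_def L.redundancy_def pos by simp
  qed
  have "ergodic_process M X" if wm: "weakly_mixing_process M X"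
    unfolding erg
  proof (intro ballI)
    fix C D assume CD: "C \<in> sets path_space" "D \<in> sets path_space"
    let ?c = "L.prob C * L.prob D" and ?q = "\<lambda>t::nat. L.prob (C \<inter> shift (int t) -` D)"
    have "cesaro_null (\<lambda>t. \<bar>?q t - ?c\<bar>)"
      using wm CD by (simp add: mix L.decorrelation_def L.prob_shift_vimage)
    then have "(\<lambda>n. (1 / real n) * (\<Sum>t=1..n. ?q t) - ?c) \<longlonglongrightarrow> 0"
      unfolding cesaro_null_def
    proof (rule Lim_null_comparison[rotated])
      have "norm ((1 / real n) * (\<Sum>t=1..n. ?q t) - ?c) \<le> (1 / real n) * (\<Sum>t=1..n. \<bar>?q t - ?c\<bar>)"
        if "0 < n" for n
      proof -
        have "(1 / real n) * (\<Sum>t=1..n. ?q t) - ?c = (1 / real n) * (\<Sum>t=1..n. ?q t - ?c)"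
          using that by (simp add: sum_subtractf field_simps)
        then show ?thesis
          by (simp add: abs_mult divide_right_mono)
      qed
      then show "\<forall>\<^sub>F n in sequentially.
          norm ((1 / real n) * (\<Sum>t=1..n. ?q t) - ?c) \<le> (1 / real n) * (\<Sum>t=1..n. \<bar>?q t - ?c\<bar>)"
        using eventually_gt_at_top[of 0] by (rule eventually_mono[rotated])
    qed
    then show "(\<lambda>n. (1 / real n) * (\<Sum>t=1..n. ?q t)) \<longlonglongrightarrow> ?c"
      by (simp add: LIM_zero_iff)
  qed
  moreover have "\<forall>a. essinf M (X 0) < ereal a \<longrightarrow> cesaro_null (\<lambda>t. tau M X a (int t))"
    if "ergodic_process M X"
  proof (intro allI impI)
    fix a assume "essinf M (X 0) < ereal a"
    then have "0 < L.prob (orthant {(0, a)})"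
      unfolding pos by (rule M.prob_le_pos_of_essinf_less[OF X])
    then show "cesaro_null (\<lambda>t. tau M X a (int t))"
      unfolding tau using that unfolding erg
      by (intro L.cesaro_null_lag_redundancy) auto
  qed
  moreover have "weakly_mixing_process M X"
    if null: "\<forall>a. essinf M (X 0) < ereal a \<longrightarrow> cesaro_null (\<lambda>t. tau M X a (int t))"
    unfolding mix
  proof (intro ballI L.cesaro_null_decorrelation)
    fix a b :: real assume "b < a" "0 < L.prob (orthant {(0, b)})"
    then have "essinf M (X 0) \<le> ereal b" "ereal b < ereal a"
      using M.essinf_le_of_prob_le_pos[OF X] by (simp_all add: pos)
    then have "essinf M (X 0) < ereal a" by (rule le_less_trans)
    then show "cesaro_null (\<lambda>t. L.lag_redundancy a (int t))"
      using null by (simp add: tau)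
  qed
  ultimately show ?thesis
    unfolding cesaro_null_def by blast
qed

end
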